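(* Let $\ell(k) := \lim_{n\to\infty} P(2n-1-|S-S| = k)$, where $S$ is a uniformly random subset of $[n]=\{0,\dots,n-1\}$ (this limit exists for every integer $k\ge 0$). Then for every nonnegative integer $k\neq 4$, $\ell(k) < \ell(4)$.
   Context: For a positive integer $n$, $[n] := \{0,1,\dots,n-1\}$, and $S$ is chosen uniformly at random among all $2^n$ subsets of $[n]$. The difference set is $S-S := \{x-y : x,y \in S\}$. *)

theory Defs
  imports "HOL-Probability.Probability"
begin

text \<open>The set of differences; Isabelle's own \<open>S - S\<close> is set-theoretic difference.\<close>

definition diffset :: "int set \<Rightarrow> int set" where
  "diffset S = {x - y | x y. x \<in> S \<and> y \<in> S}"

text \<open>Missing differences are counted in \<open>int\<close>, so that no subtraction is truncated.\<close>

definition prob_missing :: "nat \<Rightarrow> nat \<Rightarrow> real" where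
  "prob_missing k n =
     measure_pmf.prob (pmf_of_set (Pow {0..<int n}))
       {S. 2 * int n - 1 - int (card (diffset S)) = int k}"

definition ell :: "nat \<Rightarrow> real" where
  "ell k = lim (prob_missing k)"

end

theory Submission
  imports Defs
begin

text \<open>
  The difference \<open>n - 1 - j\<close> with \<open>j\<close> small is missing from \<open>S - S\<close> iff \<open>j\<close> is missing from
  \<open>A + B\<close>, where \<open>A\<close> is the beginning of \<open>S\<close> and \<open>B\<close> its end read backwards; small differences
  are all present with probability tending to 1. So the limit at \<open>2 m\<close> is \<open>p m\<close> (\<open>gap_limit\<close>), the
  probability that \<open>A + B\<close> misses exactly \<open>m\<close> naturals for random \<open>A\<close>, \<open>B\<close>, and the limit at odd numbers
  is 0. Let \<open>q m\<close> (\<open>rooted_limit\<close>) be the same probability conditioned on \<open>0 \<in> A\<close> and \<open>0 \<in> B\<close>. Inclusion-exclusion on these two events,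
  and shifting a set that does not contain 0, give \<open>p m = q m / 4 + p (m - 1) - p (m - 2) / 4\<close>. Hence
  \<open>p 0 \<le> p 1 < p 2\<close> as soon as \<open>q 0 < 4 q 2\<close>, and \<open>p m < p 2\<close> for all \<open>m \<ge> 3\<close> as soon as
  \<open>4 (1 - q 0 - q 1 - q 2) < q 0 + q 1\<close>.

  Both inequalities are numerical (\<open>q 0\<close>, \<open>q 1\<close>, \<open>q 2\<close> are about 0.487, 0.252, 0.135). They are proved by
  revealing \<open>A\<close> and \<open>B\<close> element by element. When the revealing stops, the expected number of further
  gaps is known exactly, and a union bound with this number estimates the remaining probabilities.
\<close>

section \<open>Gaps of a sumset under random extension\<close>

definition sumset :: "nat set \<Rightarrow> nat set \<Rightarrow> nat set" where
  "sumset A B = {a + b | a b. a \<in> A \<and> b \<in> B}"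

definition gaps :: "nat \<Rightarrow> nat set \<Rightarrow> nat set \<Rightarrow> nat" where
  "gaps N A B = card ({..<N} - sumset A B)"

lemma sumset_commute: "sumset A B = sumset B A"
  unfolding sumset_def by (force simp: add.commute)

lemma gaps_commute: "gaps N A B = gaps N B A"
  by (simp add: gaps_def sumset_commute)

lemma mem_sumset_insert:
  "j \<in> sumset (insert N A) B \<longleftrightarrow> j \<in> sumset A B \<or> (N \<le> j \<and> j - N \<in> B)"
  unfolding sumset_def by (auto, metis le_add_diff_inverse)

lemma mem_sumset_insert_right:
  "j \<in> sumset A (insert N B) \<longleftrightarrow> j \<in> sumset A B \<or> (N \<le> j \<and> j - N \<in> A)"
  by (metis mem_sumset_insert sumset_commute)

lemma not_mem_sumset_beyond:
  assumes "A \<subseteq> {..<N}" "B \<subseteq> {..<N}" "2 * N \<le> Suc j"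
  shows "j \<notin> sumset A B"
  using assms by (force simp: sumset_def)

lemma gaps_Suc: "gaps (Suc N) A B = gaps N A B + of_bool (N \<notin> sumset A B)"
proof -
  have "{..<Suc N} - sumset A B = ({..<N} - sumset A B) \<union> (if N \<in> sumset A B then {} else {N})"
    by (auto simp: less_Suc_eq)
  then show ?thesis by (simp add: gaps_def)
qed

lemma gaps_insert [simp]: "gaps N (insert N A) B = gaps N A B" "gaps N A (insert N B) = gaps N A B"
proof -
  have "{..<N} - sumset (insert N A) B = {..<N} - sumset A B" for A B
    by (auto simp: mem_sumset_insert)
  then show "gaps N (insert N A) B = gaps N A B" "gaps N A (insert N B) = gaps N A B"
    by (simp_all add: gaps_def sumset_commute[of A])
qed

lemma sum_Pow_insert:
  fixes f :: "'a set \<Rightarrow> 'b::comm_monoid_add"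
  assumes "finite X" "a \<notin> X"
  shows "(\<Sum>S\<in>Pow (insert a X). f S) = (\<Sum>S\<in>Pow X. f S) + (\<Sum>S\<in>Pow X. f (insert a S))"
proof -
  have "inj_on (insert a) (Pow X)"
    using assms by (auto simp: inj_on_def)
  moreover have "Pow X \<inter> insert a ` Pow X = {}"
    using assms by auto
  ultimately show ?thesis
    using assms by (simp add: Pow_insert sum.union_disjoint sum.reindex)
qed

text \<open>The conditional expectation of \<open>g\<close> of the gap count below
  \<open>N + n\<close>, given that \<open>A\<close> and \<open>B\<close> are the parts of the two
  random sets below \<open>N\<close>.\<close>

definition ext_mean :: "nat \<Rightarrow> nat \<Rightarrow> (nat \<Rightarrow> real) \<Rightarrow> nat set \<Rightarrow> nat set \<Rightarrow> real" where
  "ext_mean N n g A B =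
     (\<Sum>A'\<in>Pow {N..<N + n}. \<Sum>B'\<in>Pow {N..<N + n}. g (gaps (N + n) (A \<union> A') (B \<union> B'))) / 4 ^ n"

lemma ext_mean_0 [simp]: "ext_mean N 0 g A B = g (gaps N A B)"
  by (simp add: ext_mean_def)

lemma ext_mean_Suc:
  "4 * ext_mean N (Suc n) g A B =
     ext_mean (Suc N) n g A B + ext_mean (Suc N) n g (insert N A) B +
     ext_mean (Suc N) n g A (insert N B) + ext_mean (Suc N) n g (insert N A) (insert N B)"
proof -
  have I: "{N..<N + Suc n} = insert N {Suc N..<Suc N + n}" by auto
  show ?thesis
    unfolding ext_mean_def I by (simp add: sum_Pow_insert sum.distrib field_simps)
qed

lemma ext_mean_commute: "ext_mean N n g A B = ext_mean N n g B A"
  unfolding ext_mean_def by (subst sum.swap) (simp add: gaps_commute)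

text \<open>
  For \<open>k < N\<close> the number \<open>N + k\<close>, if not yet in \<open>A + B\<close>, stays a gap with probability
  \<open>\<Prod>i\<le>k. miss_weight A B i\<close>. Beyond \<open>2 N\<close> each step contributes another pair of unrevealed elements,
  hence a factor 3/4, and the geometric series sums to 3.
\<close>

definition miss_weight :: "nat set \<Rightarrow> nat set \<Rightarrow> nat \<Rightarrow> real" where
  "miss_weight A B i = (if i \<in> A then 1/2 else 1) * (if i \<in> B then 1/2 else 1)"

definition future_gaps :: "nat \<Rightarrow> nat set \<Rightarrow> nat set \<Rightarrow> real" where
  "future_gaps N A B = (\<Sum>k<N. of_bool (N + k \<notin> sumset A B) * (\<Prod>i\<le>k. miss_weight A B i)) + 3 * (\<Prod>i<N. miss_weight A B i)"

lemma miss_weight_nonneg [simp]: "0 \<le> miss_weight A B i"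
  by (simp add: miss_weight_def)

lemma future_gaps_nonneg: "0 \<le> future_gaps N A B"
  unfolding future_gaps_def by (intro add_nonneg_nonneg sum_nonneg mult_nonneg_nonneg prod_nonneg) auto

text \<open>With 0 in both sets, putting \<open>N\<close> into either one covers \<open>N\<close>,
  so of the four children of a state only the one omitting \<open>N\<close> twice can gain a
  gap.\<close>

locale rooted_prefix =
  fixes N :: nat and A B :: "nat set"
  assumes sub: "A \<subseteq> {..<N}" "B \<subseteq> {..<N}" and zero: "0 \<in> A" "0 \<in> B"
begin

lemma N_pos: "0 < N" using sub zero by auto

lemma mem_sumset_new: "N \<in> sumset (insert N A) B" "N \<in> sumset A (insert N B)"
   "N \<in> sumset (insert N A) (insert N B)"
  using zero by (auto simp: mem_sumset_insert mem_sumset_insert_right)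

lemma extend:
  "rooted_prefix (Suc N) A B" "rooted_prefix (Suc N) (insert N A) B"
  "rooted_prefix (Suc N) A (insert N B)" "rooted_prefix (Suc N) (insert N A) (insert N B)"
  using sub zero by (auto simp: rooted_prefix_def less_Suc_eq)

text \<open>Tower property for the expected number of further gaps. The term for \<open>N\<close>
  has no factor 4, since \<open>N\<close> becomes a gap in at most one of the four children.\<close>

lemma future_gaps_step:
  "4 * future_gaps N A B = of_bool (N \<notin> sumset A B) +
     future_gaps (Suc N) A B + future_gaps (Suc N) (insert N A) B +
     future_gaps (Suc N) A (insert N B) + future_gaps (Suc N) (insert N A) (insert N B)"
proof -
  obtain T where N: "N = Suc T" using N_pos by (cases N) auto
  have notin: "N \<notin> A" "N \<notin> B" using sub by auto
  define W where "W k = (\<Prod>i\<le>k. miss_weight A B i)" for k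
  have old: "miss_weight A' B' i = miss_weight A B i"
    if "A' = A \<or> A' = insert N A" "B' = B \<or> B' = insert N B" "i < N" for A' B' i
    using that by (auto simp: miss_weight_def)
  have expand: "future_gaps (Suc N) A' B' =
      (\<Sum>k<T. of_bool (N + Suc k \<notin> sumset A' B') * W k)
      + of_bool (N + N \<notin> sumset A' B') * W T
      + (of_bool (Suc (N + N) \<notin> sumset A' B') + 3) * (W T * miss_weight A' B' N)"
    if AB: "A' = A \<or> A' = insert N A" "B' = B \<or> B' = insert N B" for A' B'
  proof -
    have W': "(\<Prod>i\<le>k. miss_weight A' B' i) = W k" if "k < N" for k
      unfolding W_def by (rule prod.cong[OF refl]) (rule old[OF AB], use that in simp)
    have WT: "(\<Prod>i<N. miss_weight A' B' i) = W T"
      using W'[of T] by (simp add: N lessThan_Suc_atMost)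
    have "(\<Prod>i\<le>N. miss_weight A' B' i) = W T * miss_weight A' B' N"
      using WT by (simp add: lessThan_Suc_atMost[symmetric])
    then show ?thesis
      unfolding future_gaps_def using W' WT by (simp add: N distrib_right)
  qed
  have T0: "future_gaps N A B = of_bool (N \<notin> sumset A B) * W 0
      + (\<Sum>k<T. of_bool (N + Suc k \<notin> sumset A B) * (W k * miss_weight A B (Suc k))) + 3 * W T"
    unfolding future_gaps_def W_def
    by (subst N, subst sum.lessThan_Suc_shift) (simp add: N lessThan_Suc_atMost)
  have W0: "W 0 = 1/4" using zero by (simp add: W_def miss_weight_def)
  have far: "N + N \<notin> sumset A B" "Suc (N + N) \<notin> sumset A B"
    using not_mem_sumset_beyond[OF sub] by auto
  have out: "Suc N \<notin> A" "Suc N \<notin> B" using sub by auto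
  \<comment> \<open>If not yet covered, \<open>N + Suc k\<close> stays so in (1 + [Suc k not in A])
    (1 + [Suc k not in B]) of the four children, which is
    \<open>4 * miss_weight A B (Suc k)\<close>.\<close>
  have step: "4 * (of_bool (N + Suc k \<notin> sumset A B) * (W k * miss_weight A B (Suc k))) =
     of_bool (N + Suc k \<notin> sumset A B) * W k +
     of_bool (N + Suc k \<notin> sumset (insert N A) B) * W k +
     of_bool (N + Suc k \<notin> sumset A (insert N B)) * W k +
     of_bool (N + Suc k \<notin> sumset (insert N A) (insert N B)) * W k" if "k < T" for k
    using that N by (simp add: mem_sumset_insert mem_sumset_insert_right miss_weight_def)
  have "4 * (\<Sum>k<T. of_bool (N + Suc k \<notin> sumset A B) * (W k * miss_weight A B (Suc k))) =
     (\<Sum>k<T. of_bool (N + Suc k \<notin> sumset A B) * W k) +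
     (\<Sum>k<T. of_bool (N + Suc k \<notin> sumset (insert N A) B) * W k) +
     (\<Sum>k<T. of_bool (N + Suc k \<notin> sumset A (insert N B)) * W k) +
     (\<Sum>k<T. of_bool (N + Suc k \<notin> sumset (insert N A) (insert N B)) * W k)"
    unfolding sum_distrib_left sum.distrib[symmetric] by (intro sum.cong refl step) auto
  \<comment> \<open>The constant 3 balances the rest: \<open>N + N\<close> is hit only in the last
    child and \<open>Suc (N + N)\<close> in none, so the children give 3 W T + 4 (1 + 1/2 + 1/2 +
    1/4) W T = 12 W T.\<close>
  then show ?thesis
    using far notin out W0 N_pos
    by (simp add: expand T0 mem_sumset_insert mem_sumset_insert_right miss_weight_def algebra_simps)
qed

end

text \<open>At most \<open>future_gaps\<close> further gaps are expected within any \<open>n\<close>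
  steps, so an affine minorant of \<open>g\<close> with slope \<open>-\<beta>\<close> yields a bound
  for the mean.\<close>

lemma ext_mean_ge_linear:
  assumes "rooted_prefix N A B" "\<beta> \<ge> 0"
    and "\<And>k. gaps N A B \<le> k \<Longrightarrow> \<alpha> - \<beta> * (real k - real (gaps N A B)) \<le> g k"
  shows "\<alpha> - \<beta> * future_gaps N A B \<le> ext_mean N n g A B"
  using assms
proof (induction n arbitrary: N A B \<alpha>)
  case 0
  have "\<alpha> \<le> g (gaps N A B)" using "0.prems"(3)[of "gaps N A B"] by simp
  moreover have "0 \<le> \<beta> * future_gaps N A B" using "0.prems"(2) future_gaps_nonneg by simp
  ultimately show ?case by simp
next
  case (Suc n)
  interpret rooted_prefix N A B by fact
  define c where "c = (of_bool (N \<notin> sumset A B) :: real)"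
  have g: "\<alpha> - \<beta> * (real k - real (gaps N A B)) \<le> g k" if "gaps N A B \<le> k" for k
    using that Suc.prems(3) by blast
  \<comment> \<open>In this child the base gap count rises by \<open>c\<close>, which lowers the
    intercept; hence the induction over arbitrary \<open>\<alpha>\<close>.\<close>
  have "(\<alpha> - \<beta> * c) - \<beta> * future_gaps (Suc N) A B \<le> ext_mean (Suc N) n g A B"
  proof (rule Suc.IH[OF extend(1) Suc.prems(2)])
    fix k assume k: "gaps (Suc N) A B \<le> k"
    show "(\<alpha> - \<beta> * c) - \<beta> * (real k - real (gaps (Suc N) A B)) \<le> g k"
      using k g[of k] by (simp add: gaps_Suc c_def algebra_simps split: if_splits)
  qed
  moreover have "\<alpha> - \<beta> * future_gaps (Suc N) (insert N A) B \<le> ext_mean (Suc N) n g (insert N A) B"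
    using mem_sumset_new by (intro Suc.IH extend Suc.prems(2)) (auto simp: gaps_Suc g)
  moreover have "\<alpha> - \<beta> * future_gaps (Suc N) A (insert N B) \<le> ext_mean (Suc N) n g A (insert N B)"
    using mem_sumset_new by (intro Suc.IH extend Suc.prems(2)) (auto simp: gaps_Suc g)
  moreover have "\<alpha> - \<beta> * future_gaps (Suc N) (insert N A) (insert N B)
      \<le> ext_mean (Suc N) n g (insert N A) (insert N B)"
    using mem_sumset_new by (intro Suc.IH extend Suc.prems(2)) (auto simp: gaps_Suc g)
  ultimately have "4 * \<alpha> - \<beta> * (c + future_gaps (Suc N) A B + future_gaps (Suc N) (insert N A) B
      + future_gaps (Suc N) A (insert N B) + future_gaps (Suc N) (insert N A) (insert N B))
      \<le> 4 * ext_mean N (Suc n) g A B"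
    unfolding ext_mean_Suc by (simp add: algebra_simps)
  then have "4 * \<alpha> - \<beta> * (4 * future_gaps N A B) \<le> 4 * ext_mean N (Suc n) g A B"
    unfolding future_gaps_step c_def .
  then show ?case by simp
qed

section \<open>Exhaustive evaluation\<close>

fun list_or :: "bool list \<Rightarrow> bool list \<Rightarrow> bool list" where
  "list_or (x # xs) (y # ys) = (x \<or> y) # list_or xs ys"
| "list_or _ _ = []"

fun dbl_unless :: "bool \<Rightarrow> int \<Rightarrow> int" where
  "dbl_unless True x = x"
| "dbl_unless False x = 2 * x"

fun add_unless :: "bool \<Rightarrow> int \<Rightarrow> int \<Rightarrow> int" where
  "add_unless True p x = x"
| "add_unless False p x = p + x"

text \<open>Integer form of the nested sum in \<open>future_gaps\<close>: each level carries the
  factor \<open>4 * miss_weight\<close>, one doubling per absent bit, and the base value 3 is the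
  geometric tail.\<close>

fun horner :: "int list \<Rightarrow> bool list \<Rightarrow> bool list \<Rightarrow> bool list \<Rightarrow> int" where
  "horner (p # ps) (c # cs) (a # as) (b # bs) =
     dbl_unless a (dbl_unless b (add_unless c p (horner ps cs as bs)))"
| "horner _ _ _ _ = 3"

text \<open>Index 0 causes no doubling, since 0 lies in both sets and
  \<open>4 * miss_weight A B 0 = 1\<close>; hence the bits start at 1.\<close>

fun future_gaps_num :: "int list \<Rightarrow> bool list \<Rightarrow> bool list \<Rightarrow> bool list \<Rightarrow> int" where
  "future_gaps_num (p # ps) (c # cs) as bs = add_unless c p (horner ps cs as bs)"
| "future_gaps_num _ _ _ _ = 0"

fun scale16 :: "nat \<Rightarrow> int \<Rightarrow> int" where
  "scale16 0 x = x"
| "scale16 (Suc n) x = scale16 n (16 * x)"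

text \<open>
  The arguments of a function on states \<open>(m, ps, cs, as, bs)\<close> encode \<open>A, B \<subseteq> {..<N}\<close>, both containing 0:
  \<open>m\<close> is the number of gaps below \<open>N\<close>, \<open>ps = [4 ^ (N - 1), \<dots>, 1]\<close>, \<open>cs\<close> tells which of
  \<open>N, \<dots>, 2 N - 1\<close> are in \<open>A + B\<close>, and \<open>as\<close>, \<open>bs\<close> are the bits of \<open>1, \<dots>, N - 1\<close>. Values at a leaf are
  scaled by \<open>4 ^ (N + 1)\<close>; every level of the tree costs another factor of 16, since the leaves at the
  bottom have a larger \<open>N\<close> and the average over four children is replaced by their sum.
\<close>

type_synonym 'a on_state = "nat \<Rightarrow> int list \<Rightarrow> bool list \<Rightarrow> bool list \<Rightarrow> bool list \<Rightarrow> 'a"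

text \<open>Once the flag of \<open>N\<close> is removed, adding \<open>N\<close> to
  \<open>A\<close> covers \<open>N + i\<close> for each \<open>i\<close> in \<open>B\<close>, hence
  \<open>list_or cs bs\<close>, and symmetrically. The two new flags stand for \<open>2 N\<close>,
  hit only if both sets receive \<open>N\<close>, and for \<open>2 N + 1\<close>, not hit
  yet.\<close>

fun tree :: "(nat \<Rightarrow> bool list \<Rightarrow> bool) \<Rightarrow> int on_state \<Rightarrow> nat \<Rightarrow> int on_state" where
  "tree stop leaf 0 m ps cs as bs = leaf m ps cs as bs"
| "tree stop leaf (Suc n) m ps [] as bs = 0"
| "tree stop leaf (Suc n) m ps (c # cs) as bs =
    (if stop m (c # cs) then scale16 (Suc n) (leaf m ps (c # cs) as bs)
     else tree stop leaf n (if c then m else Suc m) (4 * hd ps # ps)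
            (cs @ [False, False]) (as @ [False]) (bs @ [False])
       + (tree stop leaf n m (4 * hd ps # ps)
            (list_or cs bs @ [False, False]) (as @ [True]) (bs @ [False])
       + (tree stop leaf n m (4 * hd ps # ps)
            (list_or cs as @ [False, False]) (as @ [False]) (bs @ [True])
       + tree stop leaf n m (4 * hd ps # ps)
            (list_or (list_or cs as) bs @ [True, False]) (as @ [True]) (bs @ [True]))))"

text \<open>For \<open>A = B\<close>, the two asymmetric children have equal means and only one is evaluated.\<close>

fun diag_tree :: "(nat \<Rightarrow> bool list \<Rightarrow> bool) \<Rightarrow> int on_state \<Rightarrow> nat \<Rightarrow>
    nat \<Rightarrow> int list \<Rightarrow> bool list \<Rightarrow> bool list \<Rightarrow> int" where
  "diag_tree stop leaf 0 m ps cs as = leaf m ps cs as as"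
| "diag_tree stop leaf (Suc n) m ps [] as = 0"
| "diag_tree stop leaf (Suc n) m ps (c # cs) as =
    (if stop m (c # cs) then scale16 (Suc n) (leaf m ps (c # cs) as as)
     else diag_tree stop leaf n (if c then m else Suc m) (4 * hd ps # ps)
            (cs @ [False, False]) (as @ [False])
       + (2 * tree stop leaf n m (4 * hd ps # ps)
            (list_or cs as @ [False, False]) (as @ [True]) (as @ [False])
       + diag_tree stop leaf n m (4 * hd ps # ps)
            (list_or cs as @ [True, False]) (as @ [True])))"

section \<open>Correctness of the encoding by bit lists\<close>

definition bits :: "nat \<Rightarrow> nat set \<Rightarrow> bool list" where
  "bits N A = map (\<lambda>i. i \<in> A) [1..<N]"

definition cov :: "nat \<Rightarrow> nat set \<Rightarrow> nat set \<Rightarrow> bool list" where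
  "cov N A B = map (\<lambda>i. N + i \<in> sumset A B) [0..<N]"

definition pows :: "nat \<Rightarrow> int list" where
  "pows N = rev (map (\<lambda>i. 4 ^ i) [0..<N])"

definition eval_at :: "'a on_state \<Rightarrow> nat \<Rightarrow> nat set \<Rightarrow> nat set \<Rightarrow> 'a" where
  "eval_at f N A B = f (gaps N A B) (pows N) (cov N A B) (bits N A) (bits N B)"

lemma pows_Suc: "pows (Suc N) = 4 ^ N # pows N"
  by (simp add: pows_def)

lemma hd_pows: "0 < N \<Longrightarrow> 4 * hd (pows N) = 4 ^ N"
  by (cases N) (simp_all add: pows_Suc)

lemma scale16: "scale16 n x = 16 ^ n * x"
  by (induction n arbitrary: x) simp_all

lemma list_or_map: "list_or (map f xs) (map g xs) = map (\<lambda>x. f x \<or> g x) xs"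
  by (induction xs) simp_all

text \<open>\<open>w k\<close> is a common factor of all terms. Pulling it out moves the window by
  one, so its start \<open>k\<close> is arbitrary in the induction.\<close>

lemma horner_eq:
  fixes a b c :: "nat \<Rightarrow> bool"
  defines "w \<equiv> \<lambda>i. (if a i then 1/2 else 1) * (if b i then 1/2 else 1 :: real)"
  shows "real_of_int (horner (pows n) (map c [k..<k + n]) (map a [k..<k + n]) (map b [k..<k + n])) =
    4 ^ n * ((\<Sum>i<n. of_bool (\<not> c (k + i)) * (\<Prod>l\<le>i. w (k + l))) + 3 * (\<Prod>l<n. w (k + l)))"
proof (induction n arbitrary: k)
  case 0
  then show ?case by (simp add: pows_def)
next
  case (Suc n)
  define R where "R = (\<Sum>i<n. of_bool (\<not> c (Suc k + i)) * (\<Prod>l\<le>i. w (Suc k + l)))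
     + 3 * (\<Prod>l<n. w (Suc k + l))"
  have upt: "[k..<k + Suc n] = k # [Suc k..<Suc k + n]"
    by (simp add: upt_rec)
  have dbl: "real_of_int (dbl_unless z x) = 2 * (if z then 1/2 else 1) * real_of_int x" for z x
    by (cases z) simp_all
  have add: "real_of_int (add_unless z p x) = of_bool (\<not> z) * real_of_int p + real_of_int x" for z p x
    by (cases z) simp_all
  have "real_of_int (horner (pows (Suc n)) (map c [k..<k + Suc n]) (map a [k..<k + Suc n])
      (map b [k..<k + Suc n])) = 4 * w k * (of_bool (\<not> c k) * 4 ^ n + 4 ^ n * R)"
    unfolding upt pows_Suc list.map horner.simps dbl add Suc.IH[of "Suc k"] R_def[symmetric]
    by (simp add: w_def)
  also have "\<dots> = 4 ^ Suc n * (of_bool (\<not> c k) * w k + w k * R)"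
    by (simp add: algebra_simps)
  also have "of_bool (\<not> c k) * w k + w k * R =
    (\<Sum>i<Suc n. of_bool (\<not> c (k + i)) * (\<Prod>l\<le>i. w (k + l))) + 3 * (\<Prod>l<Suc n. w (k + l))"
    unfolding sum.lessThan_Suc_shift prod.lessThan_Suc_shift prod.atMost_Suc_shift R_def
    by (simp add: prod.atMost_Suc_shift sum_distrib_left algebra_simps del: sum_of_bool_mult_eq sum_mult_of_bool_eq)
  finally show ?case .
qed

context rooted_prefix
begin

lemma cov_Cons: "cov N A B = (N \<in> sumset A B) # map (\<lambda>i. N + i \<in> sumset A B) [1..<N]"
  using N_pos by (simp add: cov_def upt_rec)

lemma bits_Suc:
  "bits (Suc N) A = bits N A @ [False]" "bits (Suc N) (insert N A) = bits N A @ [True]"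
  "bits (Suc N) B = bits N B @ [False]" "bits (Suc N) (insert N B) = bits N B @ [True]"
  using N_pos sub by (auto simp: bits_def)

lemma cov_Suc_general:
  "cov (Suc N) A' B' = map (\<lambda>i. N + i \<in> sumset A' B') [1..<N]
     @ [N + N \<in> sumset A' B', Suc (N + N) \<in> sumset A' B']"
proof -
  obtain T where N: "N = Suc T" using N_pos by (cases N) auto
  have "map (\<lambda>i. Suc N + i \<in> sumset A' B') [0..<T] = map (\<lambda>i. N + i \<in> sumset A' B') [1..<N]"
    unfolding N One_nat_def map_Suc_upt[symmetric] by simp
  then show ?thesis by (simp add: cov_def N)
qed

lemma cov_Suc:
  defines "cs \<equiv> map (\<lambda>i. N + i \<in> sumset A B) [1..<N]"
  shows "cov (Suc N) A B = cs @ [False, False]"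
    "cov (Suc N) (insert N A) B = list_or cs (bits N B) @ [False, False]"
    "cov (Suc N) A (insert N B) = list_or cs (bits N A) @ [False, False]"
    "cov (Suc N) (insert N A) (insert N B) = list_or (list_or cs (bits N A)) (bits N B) @ [True, False]"
proof -
  have far: "N + N \<notin> sumset A B" "Suc (N + N) \<notin> sumset A B"
    using not_mem_sumset_beyond[OF sub] by auto
  have out: "N \<notin> A" "N \<notin> B" "Suc N \<notin> A" "Suc N \<notin> B" using sub by auto
  show "cov (Suc N) A B = cs @ [False, False]"
    "cov (Suc N) (insert N A) B = list_or cs (bits N B) @ [False, False]"
    "cov (Suc N) A (insert N B) = list_or cs (bits N A) @ [False, False]"
    "cov (Suc N) (insert N A) (insert N B) = list_or (list_or cs (bits N A)) (bits N B) @ [True, False]"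
    using far out
    by (auto simp: cov_Suc_general cs_def bits_def list_or_map mem_sumset_insert
        mem_sumset_insert_right)
qed

lemma gaps_Suc_insert:
  "gaps (Suc N) (insert N A) B = gaps N A B" "gaps (Suc N) A (insert N B) = gaps N A B"
  "gaps (Suc N) (insert N A) (insert N B) = gaps N A B"
  using mem_sumset_new by (simp_all add: gaps_Suc)

lemma future_gaps_num_eq: "real_of_int (eval_at (\<lambda>_. future_gaps_num) N A B) = 4 ^ N * future_gaps N A B"
proof -
  obtain T where N: "N = Suc T" using N_pos by (cases N) auto
  have [simp]: "miss_weight A B 0 = 1/4" using zero by (simp add: miss_weight_def)
  have sum_shift: "(\<Sum>k<N. f k) = f 0 + (\<Sum>k<T. f (Suc k))"
    and prod_shift: "(\<Prod>k<N. f k) = f 0 * (\<Prod>k<T. f (Suc k))"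
    and power_N: "(4::real) ^ N = 4 * 4 ^ T" for f :: "nat \<Rightarrow> real"
    unfolding N by (rule sum.lessThan_Suc_shift prod.lessThan_Suc_shift power_Suc)+
  have add: "real_of_int (add_unless z p x) = of_bool (\<not> z) * real_of_int p + real_of_int x" for z p x
    by (cases z) simp_all
  have "real_of_int (eval_at (\<lambda>_. future_gaps_num) N A B) = of_bool (N \<notin> sumset A B) * 4 ^ T
    + real_of_int (horner (pows T) (map (\<lambda>i. N + i \<in> sumset A B) [1..<1 + T])
        (map (\<lambda>i. i \<in> A) [1..<1 + T]) (map (\<lambda>i. i \<in> B) [1..<1 + T]))"
    unfolding eval_at_def cov_Cons by (simp add: bits_def N pows_Suc add)
  also have "\<dots> = of_bool (N \<notin> sumset A B) * 4 ^ T +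
     4 ^ T * ((\<Sum>i<T. of_bool (N + Suc i \<notin> sumset A B) * (\<Prod>l\<le>i. miss_weight A B (Suc l)))
       + 3 * (\<Prod>l<T. miss_weight A B (Suc l)))"
    using horner_eq[where a = "\<lambda>i. i \<in> A" and b = "\<lambda>i. i \<in> B"
        and c = "\<lambda>i. N + i \<in> sumset A B" and k = 1 and n = T]
    by (simp only: miss_weight_def plus_1_eq_Suc)
  also have "\<dots> = 4 ^ N * future_gaps N A B"
    unfolding future_gaps_def sum_shift prod_shift prod.atMost_Suc_shift power_N
    by (simp add: prod.atMost_Suc_shift sum_distrib_left algebra_simps del: sum_of_bool_mult_eq sum_mult_of_bool_eq)
  finally show ?thesis .
qed

lemma tree_Suc:
  "eval_at (tree stop leaf (Suc n)) N A B =
    (if stop (gaps N A B) (cov N A B) then 16 ^ Suc n * eval_at leaf N A B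
     else eval_at (tree stop leaf n) (Suc N) A B + (eval_at (tree stop leaf n) (Suc N) (insert N A) B
       + (eval_at (tree stop leaf n) (Suc N) A (insert N B)
       + eval_at (tree stop leaf n) (Suc N) (insert N A) (insert N B))))"
  by (simp add: eval_at_def cov_Cons cov_Suc bits_Suc gaps_Suc gaps_Suc_insert pows_Suc hd_pows N_pos scale16
    mem_sumset_new del: scale16.simps)

end

text \<open>Any \<open>stop\<close> is allowed, because the leaf bound is valid at every node. The
  slack \<open>k\<close> makes the bound uniform over all longer horizons, as the limit requires.
  \<open>Suc n\<close> in the leaf hypothesis lets a leaf look one step ahead.\<close>

lemma tree_sound:
  assumes leaf: "\<And>N A B n. rooted_prefix N A B \<Longrightarrow>
      real_of_int (eval_at leaf N A B) \<le> 4 ^ Suc N * ext_mean N (Suc n) g A B"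
    and "rooted_prefix N A B"
  shows "real_of_int (eval_at (tree stop leaf n) N A B) \<le> 4 ^ (Suc N + 2 * n) * ext_mean N (Suc (k + n)) g A B"
  using \<open>rooted_prefix N A B\<close>
proof (induction n arbitrary: N A B)
  case 0
  have "eval_at (tree stop leaf 0) N A B = eval_at leaf N A B" by (simp add: eval_at_def)
  then show ?case using leaf[OF 0, of k] by simp
next
  case (Suc n)
  interpret rooted_prefix N A B by fact
  show ?case
  proof (cases "stop (gaps N A B) (cov N A B)")
    case True
    have "16 ^ Suc n * real_of_int (eval_at leaf N A B) \<le> 16 ^ Suc n * (4 ^ Suc N * ext_mean N (Suc (k + Suc n)) g A B)"
      by (intro mult_left_mono leaf Suc.prems) simp
    also have "\<dots> = 4 ^ (Suc N + 2 * Suc n) * ext_mean N (Suc (k + Suc n)) g A B"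
      by (simp add: power_add power_mult)
    finally show ?thesis using True by (simp add: tree_Suc)
  next
    case False
    have "real_of_int (eval_at (tree stop leaf (Suc n)) N A B) \<le> 4 ^ (Suc (Suc N) + 2 * n) *
      (4 * ext_mean N (Suc (k + Suc n)) g A B)"
      using Suc.IH[OF extend(1)] Suc.IH[OF extend(2)] Suc.IH[OF extend(3)] Suc.IH[OF extend(4)] False
      unfolding ext_mean_Suc[of N] by (simp add: tree_Suc distrib_left)
    then show ?thesis by (simp add: power_add algebra_simps)
  qed
qed

definition eval_diag :: "(nat \<Rightarrow> int list \<Rightarrow> bool list \<Rightarrow> bool list \<Rightarrow> int) \<Rightarrow> nat \<Rightarrow> nat set \<Rightarrow> int" where
  "eval_diag f N A = f (gaps N A A) (pows N) (cov N A A) (bits N A)"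

lemma diag_tree_Suc:
  assumes "rooted_prefix N A A"
  shows "eval_diag (diag_tree stop leaf (Suc n)) N A =
    (if stop (gaps N A A) (cov N A A) then 16 ^ Suc n * eval_at leaf N A A
     else eval_diag (diag_tree stop leaf n) (Suc N) A + (2 * eval_at (tree stop leaf n) (Suc N) (insert N A) A
       + eval_diag (diag_tree stop leaf n) (Suc N) (insert N A)))"
proof -
  interpret rooted_prefix N A A by fact
  have "list_or (list_or xs ys) ys = list_or xs ys" for xs ys
    by (induction xs ys rule: list_or.induct) auto
  then show ?thesis
    by (simp add: eval_at_def eval_diag_def cov_Cons cov_Suc bits_Suc gaps_Suc gaps_Suc_insert pows_Suc
        hd_pows N_pos scale16 mem_sumset_new del: scale16.simps)
qed

lemma diag_tree_sound:
  assumes leaf: "\<And>N A B n. rooted_prefix N A B \<Longrightarrow>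
      real_of_int (eval_at leaf N A B) \<le> 4 ^ Suc N * ext_mean N (Suc n) g A B"
    and "rooted_prefix N A A"
  shows "real_of_int (eval_diag (diag_tree stop leaf n) N A) \<le> 4 ^ (Suc N + 2 * n) * ext_mean N (Suc (k + n)) g A A"
  using \<open>rooted_prefix N A A\<close>
proof (induction n arbitrary: N A)
  case 0
  then show ?case using leaf[OF 0, of k] by (simp add: eval_at_def eval_diag_def)
next
  case (Suc n)
  interpret rooted_prefix N A A by fact
  show ?case
  proof (cases "stop (gaps N A A) (cov N A A)")
    case True
    have "16 ^ Suc n * real_of_int (eval_at leaf N A A) \<le> 16 ^ Suc n * (4 ^ Suc N * ext_mean N (Suc (k + Suc n)) g A A)"
      by (intro mult_left_mono leaf Suc.prems) simp
    also have "\<dots> = 4 ^ (Suc N + 2 * Suc n) * ext_mean N (Suc (k + Suc n)) g A A"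
      by (simp add: power_add power_mult)
    finally show ?thesis using True by (simp add: diag_tree_Suc Suc.prems)
  next
    case False
    have "real_of_int (eval_diag (diag_tree stop leaf (Suc n)) N A) \<le> 4 ^ (Suc (Suc N) + 2 * n) *
      (4 * ext_mean N (Suc (k + Suc n)) g A A)"
      using Suc.IH[OF extend(1)] Suc.IH[OF extend(4)] False
        tree_sound[OF leaf extend(2), where n=n and k=k and stop=stop]
      unfolding ext_mean_Suc[of N] ext_mean_commute[of "Suc N" _ g A "insert N A"]
      by (simp add: diag_tree_Suc Suc.prems distrib_left)
    then show ?thesis by (simp add: power_add algebra_simps)
  qed
qed

fun all_covered :: "nat \<Rightarrow> bool list \<Rightarrow> bool" where
  "all_covered 0 cs = True"
| "all_covered (Suc k) [] = False"
| "all_covered (Suc k) (c # cs) = (c \<and> all_covered k cs)"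

text \<open>
  The conditional mean of \<open>score2\<close> tends to \<open>4 q 2 - q 0\<close>. The leaf values are lower bounds: with \<open>c\<close> the
  statement that \<open>N\<close> is covered, \<open>U\<close> the expected number of further gaps, and \<open>U'\<close> the same number when
  \<open>N\<close> turns out to be a gap, they are \<open>-1\<close> or \<open>-3/4\<close> for no gap, \<open>0\<close> or \<open>max 0 (1 - U')\<close> for one, and
  \<open>max 0 (4 (1 - U))\<close> or \<open>max 0 (4 (1 - U) + U')\<close> for two, according to whether \<open>c\<close> holds.
\<close>

definition score2 :: "nat \<Rightarrow> real" where
  "score2 k = (if k = 0 then - 1 else if k = 2 then 4 else 0)"

fun leaf2 :: "int on_state" where
  "leaf2 0 ps cs as bs = (if hd cs then - 16 * hd ps else - 12 * hd ps)"
| "leaf2 (Suc 0) ps cs as bs =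
    (if hd cs then 0
     else max 0 (16 * hd ps
       - future_gaps_num (4 * hd ps # ps) (tl cs @ [False, False]) (as @ [False]) (bs @ [False])))"
| "leaf2 (Suc (Suc 0)) ps cs as bs =
    max 0 (16 * (4 * hd ps - future_gaps_num ps cs as bs)
      + (if hd cs then 0
         else future_gaps_num (4 * hd ps # ps) (tl cs @ [False, False]) (as @ [False]) (bs @ [False])))"
| "leaf2 (Suc (Suc (Suc m))) ps cs as bs = 0"

text \<open>With three gaps \<open>score2\<close> stays 0 for good; with the next five numbers
  covered, little is lost by using the leaf estimate.\<close>

definition stop2 :: "nat \<Rightarrow> bool list \<Rightarrow> bool" where
  "stop2 m cs = (2 < m \<or> all_covered 5 cs)"

text \<open>The conditional mean of \<open>score3\<close> tends to \<open>2 (q 0 + q 1) - 8 (1 - q 0 - q 1 - q 2)\<close>.\<close>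

definition score3 :: "nat \<Rightarrow> real" where
  "score3 k = (if k \<le> 1 then 2 else if k = 2 then 0 else - 8)"

fun leaf3 :: "int on_state" where
  "leaf3 0 ps cs as bs = 32 * hd ps - 16 * future_gaps_num ps cs as bs"
| "leaf3 (Suc 0) ps cs as bs = 32 * hd ps - 20 * future_gaps_num ps cs as bs"
| "leaf3 (Suc (Suc 0)) ps cs as bs = - 32 * future_gaps_num ps cs as bs"
| "leaf3 (Suc (Suc (Suc m))) ps cs as bs = - 128 * hd ps"

definition stop3 :: "nat \<Rightarrow> bool list \<Rightarrow> bool" where
  "stop3 m cs = (2 < m)"

section \<open>Estimates at the leaves\<close>

context rooted_prefix
begin

lemma hd_cov: "hd (cov N A B) = (N \<in> sumset A B)"
  by (simp add: cov_Cons)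

lemma real_hd_pows: "real_of_int (hd (pows N)) = 4 ^ N / 4"
  using arg_cong[OF hd_pows[OF N_pos], of real_of_int] by simp

lemma future_gaps_num_here: "real_of_int (future_gaps_num (pows N) (cov N A B) (bits N A) (bits N B)) = 4 ^ N * future_gaps N A B"
  using future_gaps_num_eq by (simp add: eval_at_def)

lemma future_gaps_num_next:
  "real_of_int (future_gaps_num (4 * hd (pows N) # pows N) (tl (cov N A B) @ [False, False])
     (bits N A @ [False]) (bits N B @ [False])) = 4 ^ Suc N * future_gaps (Suc N) A B"
  using rooted_prefix.future_gaps_num_eq[OF extend(1)]
  by (simp add: eval_at_def cov_Cons cov_Suc bits_Suc pows_Suc hd_pows N_pos)

end

text \<open>Three affine minorants of \<open>score2\<close>: -1 everywhere, 0 from one gap on, and 4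
  - 4 (k - 2) from two gaps on.\<close>

lemma ext_mean_score2_ge:
  assumes "rooted_prefix N A B"
  shows "- 1 \<le> ext_mean N n score2 A B"
    and "0 < gaps N A B \<Longrightarrow> 0 \<le> ext_mean N n score2 A B"
    and "gaps N A B = 2 \<Longrightarrow> 4 - 4 * future_gaps N A B \<le> ext_mean N n score2 A B"
  using ext_mean_ge_linear[OF assms, of 0 "- 1" score2] ext_mean_ge_linear[OF assms, of 0 0 score2]
    ext_mean_ge_linear[OF assms, of 4 4 score2]
  by (auto simp: score2_def)

lemma leaf2_sound:
  assumes "rooted_prefix N A B"
  shows "real_of_int (eval_at leaf2 N A B) \<le> 4 ^ Suc N * ext_mean N (Suc n) score2 A B"
proof -
  interpret rooted_prefix N A B by fact
  let ?V = "ext_mean N (Suc n) score2 A B"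
  let ?c = "N \<in> sumset A B"
  note ge0 = ext_mean_score2_ge[OF assms, of "Suc n"]
  note ge1 = ext_mean_score2_ge[OF extend(1), of n]
  note ge2 = ext_mean_score2_ge[OF extend(2), of n]
  note ge3 = ext_mean_score2_ge[OF extend(3), of n]
  note ge4 = ext_mean_score2_ge[OF extend(4), of n]
  note V = ext_mean_Suc[of N n score2 A B]
  note G = gaps_Suc_insert
  note P = real_hd_pows hd_cov future_gaps_num_here future_gaps_num_next
  have G0: "gaps (Suc N) A B = gaps N A B + of_bool (\<not> ?c)" by (rule gaps_Suc)
  consider "gaps N A B = 0" | "gaps N A B = Suc 0" | "gaps N A B = Suc (Suc 0)"
    | m where "gaps N A B = Suc (Suc (Suc m))"
    by (metis not0_implies_Suc)
  then show ?thesis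
  proof cases
    case 1
    \<comment> \<open>If \<open>N\<close> is uncovered, the child omitting it twice has a gap and
      mean at least 0; the other three have mean at least -1.\<close>
    have "(if ?c then - 1 else - 3/4) \<le> ?V"
      using ge0(1) ge1(1,2) ge2(1) ge3(1) ge4(1) V G0 by (auto simp: 1)
    moreover have "real_of_int (eval_at leaf2 N A B) = 4 ^ Suc N * (if ?c then - 1 else - 3/4)"
      by (simp add: eval_at_def 1 P)
    ultimately show ?thesis by simp
  next
    case 2
    \<comment> \<open>If \<open>N\<close> is uncovered, the child omitting it twice has two gaps and
      contributes a quarter of 4 - 4 U'; the others are at least 0.\<close>
    have "(if ?c then 0 else max 0 (1 - future_gaps (Suc N) A B)) \<le> ?V"
      using ge0(2) ge1(3) ge2(2) ge3(2) ge4(2) V G0 by (auto simp: 2 G)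
    moreover have "real_of_int (eval_at leaf2 N A B) =
        4 ^ Suc N * (if ?c then 0 else max 0 (1 - future_gaps (Suc N) A B))"
      by (simp add: eval_at_def 2 P of_int_max max_mult_distrib_left right_diff_distrib)
    ultimately show ?thesis by simp
  next
    case 3
    \<comment> \<open>If \<open>N\<close> is uncovered, the child with three gaps is bounded by 0,
      and \<open>future_gaps_step\<close> expresses the sum over the other three by U and
      U'.\<close>
    have "max 0 (4 * (1 - future_gaps N A B) + (if ?c then 0 else future_gaps (Suc N) A B)) \<le> ?V"
      using ge0(2,3) ge1(2) ge2(3) ge3(3) ge4(3) V G0 future_gaps_step by (auto simp: 3 G)
    moreover have "real_of_int (eval_at leaf2 N A B) =
        4 ^ Suc N * max 0 (4 * (1 - future_gaps N A B) + (if ?c then 0 else future_gaps (Suc N) A B))"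
      by (simp add: eval_at_def 3 P of_int_max max_mult_distrib_left right_diff_distrib distrib_left)
    ultimately show ?thesis by simp
  next
    case 4
    then show ?thesis using ge0(2) by (simp add: eval_at_def)
  qed
qed

lemma leaf3_sound:
  assumes "rooted_prefix N A B"
  shows "real_of_int (eval_at leaf3 N A B) \<le> 4 ^ Suc N * ext_mean N (Suc n) score3 A B"
proof -
  interpret rooted_prefix N A B by fact
  let ?V = "ext_mean N (Suc n) score3 A B"
  have ge: "4 ^ Suc N * (\<alpha> - \<beta> * future_gaps N A B) \<le> 4 ^ Suc N * ?V"
    if "\<beta> \<ge> 0" "\<And>k. gaps N A B \<le> k \<Longrightarrow> \<alpha> - \<beta> * (real k - real (gaps N A B)) \<le> score3 k" for \<alpha> \<beta>
    using ext_mean_ge_linear[OF assms that] by (intro mult_left_mono) auto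
  note P = eval_at_def real_hd_pows future_gaps_num_here
  consider "gaps N A B = 0" | "gaps N A B = Suc 0" | "gaps N A B = Suc (Suc 0)"
    | m where "gaps N A B = Suc (Suc (Suc m))"
    by (metis not0_implies_Suc)
  then show ?thesis
  proof cases
    \<comment> \<open>The arguments of \<open>ge\<close> are slope and intercept. The minorants are
      2 - 4 k, 2 - 5 (k - 1), -8 (k - 2) and -8; all but the first touch \<open>score3\<close> at
      three gaps, where slope 10/3 would be exact.\<close>
    case 1
    with ge[of 4 2] show ?thesis by (auto simp: P score3_def algebra_simps)
  next
    case 2
    with ge[of 5 2] show ?thesis by (auto simp: P score3_def algebra_simps)
  next
    case 3
    with ge[of 8 0] show ?thesis by (auto simp: P score3_def algebra_simps)
  next
    case 4
    with ge[of 0 "- 8"] show ?thesis by (auto simp: P score3_def algebra_simps)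
  qed
qed

lemma rooted_prefix_root: "rooted_prefix 1 {0} {0}"
  by (simp add: rooted_prefix_def)

lemma eval_diag_root: "eval_diag f 1 {0} = f 0 [1] [False] []"
proof -
  have "sumset {0} {0} = {0}" by (auto simp: sumset_def)
  then show ?thesis by (simp add: eval_diag_def gaps_def pows_def cov_def bits_def)
qed

text \<open>\<open>\<delta>\<close> does not depend on \<open>k\<close>, so strict positivity
  survives the passage to the limit.\<close>

lemma ext_mean_root_bounded_below:
  assumes leaf: "\<And>N A B n. rooted_prefix N A B \<Longrightarrow>
      real_of_int (eval_at leaf N A B) \<le> 4 ^ Suc N * ext_mean N (Suc n) g A B"
    and pos: "0 < diag_tree stop leaf n 0 [1] [False] []"
  obtains \<delta> where "0 < \<delta>" "\<And>k. \<delta> \<le> ext_mean 1 (Suc (k + n)) g {0} {0}"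
proof
  let ?v = "real_of_int (diag_tree stop leaf n 0 [1] [False] [])"
  show "0 < ?v / 4 ^ (Suc 1 + 2 * n)" using pos by simp
  show "?v / 4 ^ (Suc 1 + 2 * n) \<le> ext_mean 1 (Suc (k + n)) g {0} {0}" for k
    using diag_tree_sound[OF leaf rooted_prefix_root, of stop n k]
    unfolding eval_diag_root by (simp only: pos_divide_le_eq zero_less_power zero_less_numeral mult.commute)
qed

text \<open>\<open>stop3\<close> cuts only where the leaf value is exact: from three gaps on,
  \<open>score3\<close> is constant.\<close>

lemma tree3_pos: "0 < diag_tree stop3 leaf3 5 0 [1] [False] []"
  by code_simp

text \<open>
  The margin is small: the value is about 0.0019 after rescaling, and it is negative for depth 8, or
  if a node is already made a leaf when only its next four numbers are covered. About 66000 nodes are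
  visited.
\<close>

lemma tree2_pos: "0 < diag_tree stop2 leaf2 9 0 [1] [False] []"
  by code_simp

section \<open>Limits of the gap probabilities\<close>

lemma ext_mean_lincomb:
  "ext_mean N n (\<lambda>k. c * f k + g k) A B = c * ext_mean N n f A B + ext_mean N n g A B"
  by (simp add: ext_mean_def sum.distrib sum_distrib_left add_divide_distrib)

lemma ext_mean_const [simp]: "ext_mean N n (\<lambda>_. c) A B = c"
proof -
  have "(4::real) ^ n = 2 ^ n * 2 ^ n" by (simp add: power_mult_distrib[symmetric])
  then show ?thesis by (simp add: ext_mean_def card_Pow)
qed

lemma ext_mean_mono: "(\<And>k. f k \<le> g k) \<Longrightarrow> ext_mean N n f A B \<le> ext_mean N n g A B"
  unfolding ext_mean_def by (intro divide_right_mono sum_mono) auto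

lemma ext_mean_sum:
  "finite J \<Longrightarrow> ext_mean N n (\<lambda>k. \<Sum>j\<in>J. f j k) A B = (\<Sum>j\<in>J. ext_mean N n (f j) A B)"
proof (induction J rule: finite_induct)
  case (insert j J)
  then show ?case using ext_mean_lincomb[of N n 1 "f j" "\<lambda>k. \<Sum>j\<in>J. f j k" A B] by simp
qed simp

lemma ext_mean_empty:
  "ext_mean 0 n g {} {} = (\<Sum>A\<in>Pow {..<n}. \<Sum>B\<in>Pow {..<n}. g (gaps n A B)) / 4 ^ n"
  by (simp add: ext_mean_def atLeast0LessThan)

lemma sum_Pow_lessThan_Suc:
  assumes "\<And>S. f (insert n S) = f S"
  shows "(\<Sum>S\<in>Pow {..<Suc n}. f S) = 2 * (\<Sum>S\<in>Pow {..<n}. f S :: real)"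
  unfolding lessThan_Suc by (simp add: sum_Pow_insert assms)

lemma sum_Pow_image:
  "inj_on h X \<Longrightarrow> (\<Sum>S\<in>Pow (h ` X). f S) = (\<Sum>S\<in>Pow X. f (h ` S))"
  by (simp add: image_Pow_surj[OF refl, symmetric] sum.reindex inj_on_image_Pow)

lemma sum_Pow_Suc_image:
  "(\<Sum>S\<in>Pow {1..<Suc n}. f S) = (\<Sum>S\<in>Pow {..<n}. f (Suc ` S))"
  using sum_Pow_image[of Suc "{..<n}" f]
  by (simp add: image_Suc_lessThan atLeastLessThanSuc_atLeastAtMost)

text \<open>Shifting one set shifts the sumset and leaves 0 as a new gap.\<close>

lemma gaps_image_Suc: "gaps (Suc n) (Suc ` A) B = Suc (gaps n A B)"
proof -
  have "sumset (Suc ` A) B = Suc ` sumset A B" unfolding sumset_def by force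
  then have "{..<Suc n} - sumset (Suc ` A) B = insert 0 (Suc ` ({..<n} - sumset A B))"
    by (auto simp: image_set_diff lessThan_Suc_eq_insert_0)
  then show ?thesis by (simp add: gaps_def card_image)
qed

text \<open>Inclusion-exclusion over the events that 0 is absent from the first and from the second
  set: each amounts to one shift, both together to two.\<close>

lemma ext_mean_recurrence:
  "4 * ext_mean 0 (Suc (Suc n)) g {} {} = ext_mean 1 (Suc n) g {0} {0}
     + 4 * ext_mean 0 (Suc n) (\<lambda>k. g (Suc k)) {} {} - ext_mean 0 n (\<lambda>k. g (Suc (Suc k))) {} {}"
proof -
  let ?m = "Suc n"
  have "ext_mean 1 ?m g {} {} + ext_mean 1 ?m g {} {0}
    = (\<Sum>A\<in>Pow {1..<Suc ?m}. \<Sum>B\<in>Pow (insert 0 {1..<Suc ?m}). g (gaps (Suc ?m) A B)) / 4 ^ ?m"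
    unfolding ext_mean_def by (subst sum_Pow_insert) (simp_all add: sum.distrib add_divide_distrib)
  also have "insert 0 {1..<Suc ?m} = {..<Suc ?m}" by auto
  \<comment> \<open>After the shift of \<open>A\<close>, the element \<open>?m\<close> of
    \<open>B\<close> is too large to affect the remaining gaps; dropping it gives the factor
    2.\<close>
  also have "(\<Sum>A\<in>Pow {1..<Suc ?m}. \<Sum>B\<in>Pow {..<Suc ?m}. g (gaps (Suc ?m) A B))
    = (\<Sum>A\<in>Pow {..<?m}. 2 * (\<Sum>B\<in>Pow {..<?m}. g (Suc (gaps ?m A B))))"
    unfolding sum_Pow_Suc_image gaps_image_Suc by (intro sum.cong refl sum_Pow_lessThan_Suc) simp
  finally have one: "ext_mean 1 ?m g {} {} + ext_mean 1 ?m g {} {0}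
      = 2 * ext_mean 0 ?m (\<lambda>k. g (Suc k)) {} {}"
    by (simp add: ext_mean_empty sum_distrib_left)
  have "gaps (Suc ?m) (Suc ` A) (Suc ` B) = Suc (Suc (gaps n A B))" for A B
    by (metis gaps_commute gaps_image_Suc)
  then have "ext_mean 1 ?m g {} {} =
      (\<Sum>A\<in>Pow {..<?m}. \<Sum>B\<in>Pow {..<?m}. g (Suc (Suc (gaps n A B)))) / 4 ^ ?m"
    by (simp add: ext_mean_def sum_Pow_Suc_image[unfolded One_nat_def])
  also have "\<dots> = (\<Sum>A\<in>Pow {..<n}. 2 * (2 * (\<Sum>B\<in>Pow {..<n}. g (Suc (Suc (gaps n A B)))))) / 4 ^ ?m"
    by (simp add: sum_Pow_lessThan_Suc sum_distrib_left)
  finally have two: "ext_mean 1 ?m g {} {} = ext_mean 0 n (\<lambda>k. g (Suc (Suc k))) {} {}"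
    by (simp add: ext_mean_empty sum_distrib_left[symmetric])
  show ?thesis
    using one two ext_mean_commute[of 1 ?m g "{}" "{0}"] ext_mean_Suc[of 0 ?m g "{}" "{}"] by simp
qed

lemma ext_mean_Suc_le:
  assumes "\<And>k. g (Suc k) \<le> g k"
  shows "ext_mean 0 (Suc n) g {} {} \<le> ext_mean 0 n g {} {}"
proof -
  have "g (gaps (Suc n) A B) \<le> g (gaps n A B)" for A B
    using assms by (simp add: gaps_Suc)
  then have "ext_mean 0 (Suc n) g {} {}
      \<le> (\<Sum>A\<in>Pow {..<Suc n}. \<Sum>B\<in>Pow {..<Suc n}. g (gaps n A B)) / 4 ^ Suc n"
    unfolding ext_mean_empty by (intro divide_right_mono sum_mono) auto
  also have "\<dots> = ext_mean 0 n g {} {}"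
    by (simp add: ext_mean_empty sum_Pow_lessThan_Suc sum_distrib_left[symmetric])
  finally show ?thesis .
qed

section \<open>Limiting distributions and their comparison\<close>

definition gap_prob :: "nat \<Rightarrow> nat \<Rightarrow> real" where
  "gap_prob n m = ext_mean 0 n (\<lambda>k. of_bool (k = m)) {} {}"

definition rooted_gap_prob :: "nat \<Rightarrow> nat \<Rightarrow> real" where
  "rooted_gap_prob n m = ext_mean 1 n (\<lambda>k. of_bool (k = m)) {0} {0}"

text \<open>Gaps persist when the horizon grows, so the distribution functions decrease in
  \<open>n\<close> and converge; a point mass is a difference of two of them.\<close>

lemma gap_prob_convergent: "convergent (\<lambda>n. gap_prob n m)"
proof -
  let ?C = "\<lambda>m n. ext_mean 0 n (\<lambda>k. of_bool (k \<le> m)) {} {}"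
  have C: "convergent (?C m)" for m
  proof (rule monoseq_imp_convergent_iff_Bseq[THEN iffD2])
    have "decseq (?C m)"
      by (intro decseq_SucI ext_mean_Suc_le) simp
    then show "monoseq (?C m)" by (rule decseq_imp_monoseq)
    have "\<bar>?C m n\<bar> \<le> 1" for n
      using ext_mean_mono[of "\<lambda>_. 0" "\<lambda>k. of_bool (k \<le> m)" 0 n "{}" "{}"]
        ext_mean_mono[of "\<lambda>k. of_bool (k \<le> m)" "\<lambda>_. 1" 0 n "{}" "{}"] by simp
    then show "Bseq (?C m)" by (intro BseqI'[of _ 1]) simp
  qed
  show ?thesis
  proof (cases m)
    case 0
    then show ?thesis using C[of 0] by (simp add: gap_prob_def)
  next
    case (Suc l)
    have "(\<lambda>k. of_bool (k = m)) = (\<lambda>k. (- 1) * of_bool (k \<le> l) + (of_bool (k \<le> m) :: real))"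
      by (auto simp: Suc fun_eq_iff)
    then have "gap_prob n m = - 1 * ?C l n + ?C m n" for n
      unfolding gap_prob_def by (simp only: ext_mean_lincomb)
    then have "(\<lambda>n. gap_prob n m) = (\<lambda>n. ?C m n - ?C l n)" by (simp add: fun_eq_iff)
    then show ?thesis using convergent_diff[OF C[of m] C[of l]] by (simp only:)
  qed
qed

definition gap_limit :: "nat \<Rightarrow> real" where
  "gap_limit m = lim (\<lambda>n. gap_prob n m)"

text \<open>The recurrence solved for the rooted term; \<open>rooted_gap_prob_tendsto\<close> shows
  that this is the limit of \<open>rooted_gap_prob\<close>.\<close>

definition rooted_limit :: "nat \<Rightarrow> real" where
  "rooted_limit m = 4 * gap_limit m - (case m of 0 \<Rightarrow> 0 | Suc l \<Rightarrow> 4 * gap_limit l - (case l of 0 \<Rightarrow> 0 | Suc i \<Rightarrow> gap_limit i))"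

lemma gap_prob_tendsto: "(\<lambda>n. gap_prob n m) \<longlonglongrightarrow> gap_limit m"
  using gap_prob_convergent by (simp add: gap_limit_def convergent_LIMSEQ_iff)

lemma rooted_gap_prob_tendsto: "(\<lambda>n. rooted_gap_prob n m) \<longlonglongrightarrow> rooted_limit m"
proof (rule LIMSEQ_imp_Suc)
  have s1: "(\<lambda>n. gap_prob (Suc n) m) \<longlonglongrightarrow> gap_limit m" and s2: "(\<lambda>n. gap_prob (Suc (Suc n)) m) \<longlonglongrightarrow> gap_limit m" for m
    using gap_prob_tendsto LIMSEQ_Suc by blast+
  have rec: "rooted_gap_prob (Suc n) m = 4 * gap_prob (Suc (Suc n)) m
      - 4 * ext_mean 0 (Suc n) (\<lambda>k. of_bool (Suc k = m)) {} {}
      + ext_mean 0 n (\<lambda>k. of_bool (Suc (Suc k) = m)) {} {}" for n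
    using ext_mean_recurrence[of n "\<lambda>k. of_bool (k = m)"] by (simp add: gap_prob_def rooted_gap_prob_def)
  show "(\<lambda>n. rooted_gap_prob (Suc n) m) \<longlonglongrightarrow> rooted_limit m"
  proof (cases m)
    case 0
    then have "(\<lambda>n. rooted_gap_prob (Suc n) m) = (\<lambda>n. 4 * gap_prob (Suc (Suc n)) 0)"
      unfolding rec by simp
    then show ?thesis using tendsto_mult[OF tendsto_const s2[of 0]] 0 by (simp add: rooted_limit_def)
  next
    case (Suc l)
    show ?thesis
    proof (cases l)
      case 0
      have "(\<lambda>n. rooted_gap_prob (Suc n) m) = (\<lambda>n. 4 * gap_prob (Suc (Suc n)) m - 4 * gap_prob (Suc n) l)"
        unfolding rec by (simp add: Suc 0 gap_prob_def)
      moreover have "\<dots> \<longlonglongrightarrow> 4 * gap_limit m - 4 * gap_limit l" by (intro tendsto_intros s1 s2)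
      ultimately show ?thesis by (simp add: rooted_limit_def Suc 0)
    next
      case (Suc i)
      have "(\<lambda>n. rooted_gap_prob (Suc n) m) =
          (\<lambda>n. 4 * gap_prob (Suc (Suc n)) m - 4 * gap_prob (Suc n) l + gap_prob n i)"
        unfolding rec by (simp add: \<open>m = Suc l\<close> Suc gap_prob_def)
      moreover have "\<dots> \<longlonglongrightarrow> 4 * gap_limit m - 4 * gap_limit l + gap_limit i"
        by (intro tendsto_intros s1 s2 gap_prob_tendsto)
      moreover have "rooted_limit m = 4 * gap_limit m - 4 * gap_limit l + gap_limit i" by (simp add: rooted_limit_def \<open>m = Suc l\<close> Suc)
      ultimately show ?thesis by (simp only:)
    qed
  qed
qed

lemma rooted_limit_nonneg: "0 \<le> rooted_limit m"
proof (rule LIMSEQ_le_const[OF rooted_gap_prob_tendsto], intro exI allI impI)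
  show "0 \<le> rooted_gap_prob n m" for n
    using ext_mean_mono[of "\<lambda>_. 0" "\<lambda>k. of_bool (k = m)" 1 n "{0}" "{0}"]
    by (simp add: rooted_gap_prob_def)
qed

lemma gap_limit_nonneg: "0 \<le> gap_limit m"
proof (rule LIMSEQ_le_const[OF gap_prob_tendsto], intro exI allI impI)
  show "0 \<le> gap_prob n m" for n
    using ext_mean_mono[of "\<lambda>_. 0" "\<lambda>k. of_bool (k = m)" 0 n "{}" "{}"]
    by (simp add: gap_prob_def)
qed

lemma sum_rooted_limit_le: "(\<Sum>k\<le>m. rooted_limit k) \<le> 1"
proof (rule LIMSEQ_le_const2[OF tendsto_sum[OF rooted_gap_prob_tendsto]], intro exI allI impI)
  show "(\<Sum>k\<le>m. rooted_gap_prob n k) \<le> 1" for n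
  proof -
    have "(\<Sum>k\<le>m. rooted_gap_prob n k) = ext_mean 1 n (\<lambda>k. \<Sum>j\<le>m. of_bool (k = j)) {0} {0}"
      by (simp only: rooted_gap_prob_def ext_mean_sum finite_atMost)
    also have "\<dots> \<le> ext_mean 1 n (\<lambda>_. 1) {0} {0}"
      by (intro ext_mean_mono) (simp add: of_bool_def)
    finally show ?thesis by simp
  qed
qed

lemma rooted_limit_0_less: "rooted_limit 0 < 4 * rooted_limit 2"
proof -
  obtain \<delta> where \<delta>: "0 < \<delta>" "\<And>k. \<delta> \<le> ext_mean 1 (Suc (k + 9)) score2 {0} {0}"
    using ext_mean_root_bounded_below[OF leaf2_sound tree2_pos] by blast
  have s: "score2 = (\<lambda>k. 4 * of_bool (k = 2) + ((- 1) * of_bool (k = 0) + 0))"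
    by (auto simp: score2_def)
  have eq: "ext_mean 1 n score2 {0} {0} = 4 * rooted_gap_prob n 2 + ((- 1) * rooted_gap_prob n 0 + 0)" for n
    unfolding rooted_gap_prob_def by (subst s) (simp only: ext_mean_lincomb ext_mean_const)
  have "(\<lambda>n. ext_mean 1 n score2 {0} {0}) \<longlonglongrightarrow> 4 * rooted_limit 2 + ((- 1) * rooted_limit 0 + 0)"
    unfolding eq by (intro tendsto_intros rooted_gap_prob_tendsto)
  from LIMSEQ_le_const[OF LIMSEQ_ignore_initial_segment[OF this, of 10], of \<delta>]
  have "\<delta> \<le> 4 * rooted_limit 2 - rooted_limit 0" using \<delta>(2) by (simp add: add.commute)
  with \<delta>(1) show ?thesis by simp
qed

lemma rooted_limit_ge_3_less: "1 - rooted_limit 0 - rooted_limit 1 - rooted_limit 2 < (rooted_limit 0 + rooted_limit 1) / 4"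
proof -
  obtain \<delta> where \<delta>: "0 < \<delta>" "\<And>k. \<delta> \<le> ext_mean 1 (Suc (k + 5)) score3 {0} {0}"
    using ext_mean_root_bounded_below[OF leaf3_sound tree3_pos] by blast
  \<comment> \<open>Relative to the constant -8, the values 2, 2, 0 become the coefficients 10, 10,
    8.\<close>
  have s: "score3 = (\<lambda>k. 10 * of_bool (k = 0) + (10 * of_bool (k = 1) + (8 * of_bool (k = 2) + (- 8))))"
    by (auto simp: score3_def)
  have eq: "ext_mean 1 n score3 {0} {0} =
      10 * rooted_gap_prob n 0 + (10 * rooted_gap_prob n 1 + (8 * rooted_gap_prob n 2 + (- 8)))" for n
    unfolding rooted_gap_prob_def by (subst s) (simp only: ext_mean_lincomb ext_mean_const)
  have "(\<lambda>n. ext_mean 1 n score3 {0} {0}) \<longlonglongrightarrow> 10 * rooted_limit 0 + (10 * rooted_limit 1 + (8 * rooted_limit 2 + (- 8)))"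
    unfolding eq by (intro tendsto_intros rooted_gap_prob_tendsto)
  from LIMSEQ_le_const[OF LIMSEQ_ignore_initial_segment[OF this, of 6], of \<delta>]
  have "\<delta> \<le> 10 * rooted_limit 0 + 10 * rooted_limit 1 + 8 * rooted_limit 2 - 8" using \<delta>(2) by (simp add: add.commute)
  with \<delta>(1) show ?thesis by simp
qed

lemma gap_limit_less:
  assumes "m \<noteq> 2"
  shows "gap_limit m < gap_limit 2"
proof -
  have rec: "gap_limit (Suc (Suc m)) = gap_limit (Suc m) - gap_limit m / 4 + rooted_limit (Suc (Suc m)) / 4" for m
    by (simp add: rooted_limit_def field_simps)
  have p0: "gap_limit 0 = rooted_limit 0 / 4" and p1: "gap_limit 1 = (rooted_limit 0 + rooted_limit 1) / 4"
    by (simp_all add: rooted_limit_def)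
  have p2: "gap_limit 2 = gap_limit 1 - gap_limit 0 / 4 + rooted_limit 2 / 4"
    using rec[of 0] by (simp add: numeral_2_eq_2)
  \<comment> \<open>The homogeneous recurrence has the double characteristic root 1/2;
    \<open>e\<close> splits off one of the two factors.\<close>
  define e where "e m = gap_limit (Suc m) - gap_limit m / 2" for m
  have e_rec: "e (Suc m) = e m / 2 + rooted_limit (Suc (Suc m)) / 4" for m
    using rec[of m] by (simp add: e_def)
  have e1: "0 \<le> e 1"
    using e_rec[of 0] rooted_limit_nonneg[of 0] rooted_limit_nonneg[of 1] rooted_limit_nonneg[of 2] p0 p1
    by (simp add: e_def numeral_2_eq_2)
  \<comment> \<open>Of the powers of 1/2 produced by \<open>e_rec\<close>, a single one is kept at
    \<open>e 1\<close>; the others are estimated by 1, by nonnegativity.\<close>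
  have e_le: "e (Suc (Suc m)) \<le> e 1 / 2 + (\<Sum>k\<le>m. rooted_limit (k + 3)) / 4" for m
  proof (induction m)
    case 0
    then show ?case using e_rec[of 1] by (simp add: numeral_3_eq_3)
  next
    case (Suc m)
    have "0 \<le> (\<Sum>k\<le>m. rooted_limit (k + 3))" by (intro sum_nonneg rooted_limit_nonneg)
    moreover have "(\<Sum>k\<le>Suc m. rooted_limit (k + 3)) = (\<Sum>k\<le>m. rooted_limit (k + 3)) + rooted_limit (Suc (Suc (Suc (Suc m))))"
      by (simp add: numeral_3_eq_3)
    ultimately show ?case using Suc e1 e_rec[of "Suc (Suc m)"] by argo
  qed
  have tail_le: "(\<Sum>k\<le>m. rooted_limit (k + 3)) \<le> 1 - rooted_limit 0 - rooted_limit 1 - rooted_limit 2" for m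
  proof -
    have "(\<Sum>k\<le>m + 3. rooted_limit k) = rooted_limit 0 + (rooted_limit 1 + (rooted_limit 2 + (\<Sum>k\<le>m. rooted_limit (k + 3))))"
      by (simp add: numeral_3_eq_3 numeral_2_eq_2 sum.atMost_Suc_shift del: sum.atMost_Suc)
    then show ?thesis using sum_rooted_limit_le[of "m + 3"] by simp
  qed
  have e_less: "e (Suc (Suc m)) < gap_limit 2 / 2" for m
  proof -
    have "e 1 = gap_limit 2 - gap_limit 1 / 2" by (simp add: e_def numeral_2_eq_2)
    \<comment> \<open>\<open>e 1 / 2\<close> is \<open>gap_limit 2 / 2 - gap_limit 1 / 4\<close>,
      and a quarter of the tail is below \<open>gap_limit 1 / 4\<close>.\<close>
    then show ?thesis using e_le[of m] tail_le[of m] rooted_limit_ge_3_less p1 by argo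
  qed
  have "gap_limit (Suc (Suc (Suc m))) < gap_limit 2" for m
  proof (induction m)
    case 0
    then show ?case using e_less[of 0] by (simp add: e_def numeral_2_eq_2)
  next
    case (Suc m)
    then show ?case using e_less[of "Suc m"] by (simp add: e_def)
  qed
  moreover have "gap_limit 1 < gap_limit 2" using rooted_limit_0_less p0 p2 by simp
  moreover have "gap_limit 0 \<le> gap_limit 1" using p0 p1 rooted_limit_nonneg[of 1] by simp
  ultimately show ?thesis
    using assms by (cases m; cases "m - 1"; cases "m - 2") (auto simp: numeral_2_eq_2)
qed

section \<open>Missing differences\<close>

lemma sum_Pow_Un:
  fixes f :: "'a set \<Rightarrow> 'b::comm_monoid_add"
  assumes "finite X" "finite Y" "X \<inter> Y = {}"
  shows "(\<Sum>S\<in>Pow (X \<union> Y). f S) = (\<Sum>P\<in>Pow X. \<Sum>R\<in>Pow Y. f (P \<union> R))"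
  using assms
proof (induction X arbitrary: f rule: finite_induct)
  case (insert a X)
  then show ?case
    using insert.IH[of "\<lambda>S. f (insert a S)"] by (simp add: sum_Pow_insert)
qed simp

text \<open>The pairs are disjoint, so they are avoided independently, each with probability
  3/4.\<close>

lemma sum_Pow_avoiding_pairs:
  assumes "finite X" "finite V" "inj_on f X" "inj_on h X" "f ` X \<inter> h ` X = {}" "f ` X \<union> h ` X \<subseteq> V"
  shows "(\<Sum>S\<in>Pow V. of_bool (\<forall>x\<in>X. \<not> (f x \<in> S \<and> h x \<in> S))) = (3/4) ^ card X * (2 :: real) ^ card V"
  using assms
proof (induction X arbitrary: V rule: finite_induct)
  case empty
  then show ?case by (simp add: card_Pow)
next
  case (insert x X)
  let ?P = "\<lambda>S. \<forall>x\<in>X. \<not> (f x \<in> S \<and> h x \<in> S)"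
  define W where "W = V - {f x, h x}"
  have ne: "f x \<noteq> h x" and V: "V = insert (f x) (insert (h x) W)"
    using insert.prems by (auto simp: W_def)
  have fresh: "f x \<notin> f ` X" "f x \<notin> h ` X" "h x \<notin> f ` X" "h x \<notin> h ` X"
    using insert.prems insert.hyps by (auto simp: inj_on_def)
  have W: "finite W" "f x \<notin> W" "h x \<notin> W" using insert.prems by (auto simp: W_def)
  then have card: "card V = Suc (Suc (card W))" using ne by (simp add: V)
  have IH: "(\<Sum>S\<in>Pow W. of_bool (?P S)) = (3/4) ^ card X * (2 :: real) ^ card W"
  proof (rule insert.IH)
    show "inj_on f X" "inj_on h X" using insert.prems(2,3) by simp_all
    show "f ` X \<inter> h ` X = {}" using insert.prems(4) by blast
    show "f ` X \<union> h ` X \<subseteq> W" using insert.prems(5) fresh unfolding W_def by blast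
  qed (rule W(1))
  have P: "?P (insert (f x) S) = ?P S" "?P (insert (h x) S) = ?P S" for S
  proof -
    have "f y \<noteq> f x" "f y \<noteq> h x" "h y \<noteq> f x" "h y \<noteq> h x" if "y \<in> X" for y
      using fresh imageI[OF that, of f] imageI[OF that, of h] by metis+
    then show "?P (insert (f x) S) = ?P S" "?P (insert (h x) S) = ?P S" by auto
  qed
  let ?F = "\<lambda>S. of_bool (\<forall>y\<in>insert x X. \<not> (f y \<in> S \<and> h y \<in> S)) :: real"
  have two: "(\<Sum>S\<in>Pow V. F S) = (\<Sum>S\<in>Pow W. F S + F (insert (h x) S) + F (insert (f x) S)
      + F (insert (f x) (insert (h x) S)))" for F :: "'b set \<Rightarrow> real"
    unfolding V using W ne by (simp add: sum_Pow_insert sum.distrib)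
  have ball: "(\<forall>y\<in>insert x X. Q y) \<longleftrightarrow> Q x \<and> (\<forall>y\<in>X. Q y)" for Q by simp
  have "(\<Sum>S\<in>Pow V. ?F S) = (\<Sum>S\<in>Pow W. 3 * of_bool (?P S))"
    unfolding two
  proof (rule sum.cong[OF refl])
    fix S assume "S \<in> Pow W"
    then have "f x \<notin> S" "h x \<notin> S" using W by auto
    then show "?F S + ?F (insert (h x) S) + ?F (insert (f x) S) + ?F (insert (f x) (insert (h x) S))
        = 3 * of_bool (?P S)"
      unfolding ball P using ne by simp
  qed
  also have "\<dots> = 3 * ((3/4) ^ card X * 2 ^ card W)"
    unfolding sum_distrib_left[symmetric] IH ..
  finally show ?case using insert.hyps by (simp add: card)
qed

section \<open>From large differences to the sumset of the two ends\<close>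

definition lower_half :: "nat \<Rightarrow> int set \<Rightarrow> nat set" where
  "lower_half n S = {i. i < n div 2 \<and> int i \<in> S}"

definition upper_half :: "nat \<Rightarrow> int set \<Rightarrow> nat set" where
  "upper_half n S = {i. i < n div 2 \<and> int n - 1 - int i \<in> S}"

text \<open>The two ends of a uniform \<open>S\<close> are independent and uniform; the middle part
  \<open>M\<close>, of at most one element, is free.\<close>

lemma sum_Pow_halves:
  "(\<Sum>S\<in>Pow {0..<int n}. g (gaps (n div 2) (lower_half n S) (upper_half n S)))
    = 2 ^ n * ext_mean 0 (n div 2) g {} {}"
proof -
  define N where "N = n div 2"
  define r where "r i = int n - 1 - int i" for i :: nat
  define M where "M = {int N..<int n - int N}"
  have N: "2 * N \<le> n" "n < 2 * N + 2" by (auto simp: N_def)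
  have inj: "inj_on int {..<N}" "inj_on r {..<N}" by (auto simp: inj_on_def r_def)
  have r: "r ` {..<N} = {int n - int N..<int n}"
  proof
    show "{int n - int N..<int n} \<subseteq> r ` {..<N}"
    proof
      fix x assume "x \<in> {int n - int N..<int n}"
      then have "x = r (nat (int n - 1 - x))" "nat (int n - 1 - x) < N" by (auto simp: r_def)
      then show "x \<in> r ` {..<N}" by blast
    qed
  qed (auto simp: r_def)
  have i: "int ` {..<N} = {0..<int N}"
    using image_int_atLeastLessThan[of 0 N] by (simp add: atLeast0LessThan)
  have split: "{0..<int n} = int ` {..<N} \<union> (r ` {..<N} \<union> M)"
    unfolding r i M_def using N by auto
  have disj: "int ` {..<N} \<inter> (r ` {..<N} \<union> M) = {}" "r ` {..<N} \<inter> M = {}"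
    unfolding r i M_def using N by auto
  have halves: "lower_half n (int ` A \<union> (r ` B \<union> T)) = A" "upper_half n (int ` A \<union> (r ` B \<union> T)) = B"
    if "A \<subseteq> {..<N}" "B \<subseteq> {..<N}" "T \<subseteq> M" for A B T
  proof -
    have "int j \<notin> r ` B \<union> T" if "j < N" for j
      using that \<open>B \<subseteq> _\<close> \<open>T \<subseteq> _\<close> N by (force simp: r_def M_def)
    then show "lower_half n (int ` A \<union> (r ` B \<union> T)) = A"
      using that(1) by (auto simp: lower_half_def N_def[symmetric])
    have "r j \<notin> int ` A \<union> T" if "j < N" for j
      using that \<open>A \<subseteq> _\<close> \<open>T \<subseteq> _\<close> N by (force simp: r_def M_def)
    moreover have "r i = r j \<longleftrightarrow> i = j" for i j by (auto simp: r_def)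
    ultimately show "upper_half n (int ` A \<union> (r ` B \<union> T)) = B"
      using that(2) by (auto simp: upper_half_def N_def[symmetric] r_def[symmetric] image_iff)
  qed
  have "card M = n - 2 * N" using N by (simp add: M_def)
  moreover have "(4::real) ^ N = 2 ^ (2 * N)" by (simp add: power_mult)
  ultimately have pow: "(2::real) ^ card M * 4 ^ N = 2 ^ n"
    using N by (simp add: power_add[symmetric])
  have "(\<Sum>S\<in>Pow {0..<int n}. g (gaps N (lower_half n S) (upper_half n S)))
    = (\<Sum>A\<in>Pow {..<N}. \<Sum>B\<in>Pow {..<N}. \<Sum>T\<in>Pow M.
        g (gaps N (lower_half n (int ` A \<union> (r ` B \<union> T))) (upper_half n (int ` A \<union> (r ` B \<union> T)))))"
    unfolding split using disj inj by (simp add: sum_Pow_Un sum_Pow_image M_def)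
  also have "\<dots> = (\<Sum>A\<in>Pow {..<N}. \<Sum>B\<in>Pow {..<N}. \<Sum>T\<in>Pow M. g (gaps N A B))"
    by (intro sum.cong refl) (simp add: halves)
  also have "\<dots> = 2 ^ card M * (\<Sum>A\<in>Pow {..<N}. \<Sum>B\<in>Pow {..<N}. g (gaps N A B))"
    by (simp add: card_Pow M_def sum_distrib_left)
  also have "\<dots> = 2 ^ n * ext_mean 0 N g {} {}"
    by (simp add: ext_mean_empty pow[symmetric])
  finally show ?thesis by (simp only: N_def)
qed

lemma uminus_mem_diffset: "- x \<in> diffset S \<longleftrightarrow> x \<in> diffset S"
  unfolding diffset_def by (smt (verit) mem_Collect_eq)

text \<open>If x - y = n - 1 - j, the distances of y and x from the ends 0 and n - 1 add up to j, so
  both lie in the halves.\<close>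

lemma mem_diffset_iff_mem_sumset:
  assumes S: "S \<subseteq> {0..<int n}" and j: "j < n div 2"
  shows "int (n - 1 - j) \<in> diffset S \<longleftrightarrow> j \<in> sumset (lower_half n S) (upper_half n S)"
proof
  have d: "int (n - 1 - j) = int n - 1 - int j" using j by auto
  {
    assume "int (n - 1 - j) \<in> diffset S"
    then obtain x y where xy: "x \<in> S" "y \<in> S" "int n - 1 - int j = x - y"
      unfolding d diffset_def by blast
    moreover have "0 \<le> y" "x < int n" using xy S by auto
    ultimately have "nat y \<in> lower_half n S" "j - nat y \<in> upper_half n S" "j = nat y + (j - nat y)"
      using j by (auto simp: lower_half_def upper_half_def of_nat_diff algebra_simps nat_le_iff)
    then show "j \<in> sumset (lower_half n S) (upper_half n S)"
      unfolding sumset_def by blast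
  }
  assume "j \<in> sumset (lower_half n S) (upper_half n S)"
  then obtain a b where "j = a + b" "int a \<in> S" "int n - 1 - int b \<in> S"
    by (auto simp: sumset_def lower_half_def upper_half_def)
  then show "int (n - 1 - j) \<in> diffset S"
    unfolding d diffset_def by (force simp: algebra_simps)
qed

text \<open>The range is what the differences \<open>n - 1 - j\<close> with
  \<open>j < n div 2\<close> leave over among the positive ones.\<close>

definition small_differences :: "nat \<Rightarrow> int set \<Rightarrow> bool" where
  "small_differences n S \<longleftrightarrow> (\<forall>d\<in>{1..n - 1 - n div 2}. int d \<in> diffset S)"

lemma missing_differences:
  assumes S: "S \<subseteq> {0..<int n}" and n: "3 \<le> n" and small: "small_differences n S"
  shows "2 * int n - 1 - int (card (diffset S)) = 2 * int (gaps (n div 2) (lower_half n S) (upper_half n S))"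
proof -
  define D where "D = {d \<in> {1..<n}. int d \<in> diffset S}"
  \<comment> \<open>Here \<open>3 \<le> n\<close> matters: 1 is then a small difference, so
    \<open>S\<close> is nonempty and 0 is a difference.\<close>
  have "1 \<in> {1..n - 1 - n div 2}" using n by simp
  then have "int 1 \<in> diffset S" using small unfolding small_differences_def by blast
  then have "0 \<in> diffset S" by (auto simp: diffset_def)
  have "diffset S = insert 0 (int ` D \<union> uminus ` int ` D)"
  proof
    show "diffset S \<subseteq> insert 0 (int ` D \<union> uminus ` int ` D)"
    proof
      fix x assume x: "x \<in> diffset S"
      then obtain a b where "x = a - b" "a \<in> S" "b \<in> S" by (auto simp: diffset_def)
      moreover from this have "a \<in> {0..<int n}" "b \<in> {0..<int n}" using S by blast+
      ultimately have "\<bar>x\<bar> < int n" by auto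
      moreover have "\<bar>x\<bar> \<in> diffset S" using x by (simp add: abs_if uminus_mem_diffset)
      ultimately have "nat \<bar>x\<bar> \<in> D" if "x \<noteq> 0" using that by (auto simp: D_def)
      moreover have "x = int (nat \<bar>x\<bar>) \<or> x = - int (nat \<bar>x\<bar>)" by auto
      ultimately show "x \<in> insert 0 (int ` D \<union> uminus ` int ` D)" by blast
    qed
    show "insert 0 (int ` D \<union> uminus ` int ` D) \<subseteq> diffset S"
      using \<open>0 \<in> diffset S\<close> by (auto simp: D_def uminus_mem_diffset)
  qed
  moreover have "finite D" by (simp add: D_def)
  moreover have "int ` D \<inter> uminus ` int ` D = {}" "0 \<notin> int ` D \<union> uminus ` int ` D"
    by (auto simp: D_def)
  ultimately have card: "card (diffset S) = Suc (2 * card D)"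
    by (simp add: card_Un_disjoint card_image inj_on_def)
  have "{1..<n} - D = (\<lambda>j. n - 1 - j) ` ({..<n div 2} - sumset (lower_half n S) (upper_half n S))"
  proof
    show "{1..<n} - D \<subseteq> (\<lambda>j. n - 1 - j) ` ({..<n div 2} - sumset (lower_half n S) (upper_half n S))"
    proof
      fix d assume d: "d \<in> {1..<n} - D"
      then have "int d \<notin> diffset S" "1 \<le> d" "d < n" by (auto simp: D_def)
      then have "\<not> d \<le> n - 1 - n div 2" using small by (auto simp: small_differences_def)
      then have j: "n - 1 - d < n div 2" "n - 1 - (n - 1 - d) = d" using \<open>1 \<le> d\<close> \<open>d < n\<close> by auto
      then have "n - 1 - d \<notin> sumset (lower_half n S) (upper_half n S)"
        using mem_diffset_iff_mem_sumset[OF S j(1)] \<open>int d \<notin> diffset S\<close> by simp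
      then show "d \<in> (\<lambda>j. n - 1 - j) ` ({..<n div 2} - sumset (lower_half n S) (upper_half n S))"
        using j by (intro image_eqI[of _ _ "n - 1 - d"]) auto
    qed
    show "(\<lambda>j. n - 1 - j) ` ({..<n div 2} - sumset (lower_half n S) (upper_half n S)) \<subseteq> {1..<n} - D"
      using mem_diffset_iff_mem_sumset[OF S] n by (auto simp: D_def)
  qed
  moreover have "inj_on (\<lambda>j. n - 1 - j) ({..<n div 2} - sumset (lower_half n S) (upper_half n S))"
    using n by (auto simp: inj_on_def)
  ultimately have "gaps (n div 2) (lower_half n S) (upper_half n S) = card ({1..<n} - D)"
    by (simp add: gaps_def card_image)
  also have "\<dots> = n - 1 - card D"
    by (subst card_Diff_subset) (auto simp: D_def)
  finally have "gaps (n div 2) (lower_half n S) (upper_half n S) = n - 1 - card D" .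
  moreover have "card D \<le> n - 1"
    using card_mono[of "{1..<n}" D] by (simp add: D_def subset_iff)
  ultimately show ?thesis using card n by simp
qed

text \<open>Cut the interval into \<open>t\<close> blocks of length \<open>2 * d\<close> and pair
  the two halves of each block. All \<open>t * d\<close> disjoint pairs must be avoided, and they
  number at least \<open>n div 4\<close> because \<open>t\<close> is positive.\<close>

lemma sum_Pow_missing_difference_le:
  assumes d: "1 \<le> d" "2 * d \<le> n"
  shows "(\<Sum>S\<in>Pow {0..<int n}. of_bool (int d \<notin> diffset S)) \<le> (3/4) ^ (n div 4) * (2::real) ^ n"
proof -
  define t where "t = n div (2 * d)"
  define X where "X = {..<t} \<times> {..<d}"
  define f where "f = (\<lambda>(i, j). int (2 * d * i + j))"
  define h where "h = (\<lambda>(i, j). int (2 * d * i + (j + d)))"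
  have "1 \<le> t" using d by (simp add: t_def div_greater_zero_iff Suc_le_eq)
  have rep: "i = i' \<and> j = j'" if "2 * d * i + j = 2 * d * i' + j'" "j < 2 * d" "j' < 2 * d" for i j i' j' :: nat
  proof -
    have "(2 * d * i + j) div (2 * d) = i" if "j < 2 * d" for i j
      using that by (subst div_mult_self4) auto
    then have "i = i'" using that by metis
    with that show ?thesis by simp
  qed
  have inj: "inj_on f X" "inj_on h X"
  proof -
    have "x = y" if "x \<in> X" "y \<in> X" "f x = f y \<or> h x = h y" for x y
      using that rep[of "fst x" "snd x" "fst y" "snd y"]
        rep[of "fst x" "snd x + d" "fst y" "snd y + d"]
      by (auto simp: f_def h_def X_def case_prod_beta prod_eq_iff simp del: of_nat_add of_nat_mult)
    then show "inj_on f X" "inj_on h X" by (auto intro!: inj_onI)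
  qed
  have disj: "f ` X \<inter> h ` X = {}"
  proof -
    have "f x \<noteq> h y" if "x \<in> X" "y \<in> X" for x y
      using that rep[of "fst x" "snd x" "fst y" "snd y + d"]
      by (auto simp: f_def h_def X_def case_prod_beta simp del: of_nat_add of_nat_mult)
    then show ?thesis by auto
  qed
  have bound: "2 * d * i + k < n" if "i < t" "k < 2 * d" for i k
  proof -
    have "2 * d * i + k < 2 * d * Suc i" using that by simp
    also have "\<dots> \<le> 2 * d * t" using that by (intro mult_left_mono) auto
    also have "\<dots> \<le> n" by (simp add: t_def)
    finally show ?thesis .
  qed
  have sub: "f ` X \<union> h ` X \<subseteq> {0..<int n}"
  proof -
    have "f x \<in> {0..<int n}" "h x \<in> {0..<int n}" if "x \<in> X" for x
      using that bound[of "fst x" "snd x"] bound[of "fst x" "snd x + d"]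
      by (auto simp: f_def h_def X_def simp del: of_nat_add of_nat_mult)
    then show ?thesis by auto
  qed
  have "n < 2 * d * Suc t"
    using dividend_less_times_div[of "2 * d" n] d by (simp add: t_def)
  also have "\<dots> \<le> 4 * (t * d)" using \<open>1 \<le> t\<close> by (simp add: algebra_simps)
  finally have card: "n div 4 \<le> card X" by (simp add: X_def)
  have "(\<Sum>S\<in>Pow {0..<int n}. of_bool (int d \<notin> diffset S)) \<le>
      (\<Sum>S\<in>Pow {0..<int n}. of_bool (\<forall>x\<in>X. \<not> (f x \<in> S \<and> h x \<in> S)) :: real)"
  proof (rule sum_mono)
    fix S
    have "int d \<in> diffset S" if "x \<in> X" "f x \<in> S" "h x \<in> S" for x
    proof -
      have "int d = h x - f x" by (auto simp: f_def h_def split: prod.splits)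
      then show ?thesis using that unfolding diffset_def by blast
    qed
    then show "of_bool (int d \<notin> diffset S) \<le> (of_bool (\<forall>x\<in>X. \<not> (f x \<in> S \<and> h x \<in> S)) :: real)"
      by (auto simp: of_bool_def)
  qed
  also have "\<dots> = (3/4) ^ card X * 2 ^ n"
    using sum_Pow_avoiding_pairs[OF _ _ inj disj sub] by (simp add: X_def)
  also have "\<dots> \<le> (3/4) ^ (n div 4) * 2 ^ n"
    using card by (intro mult_right_mono power_decreasing) auto
  finally show ?thesis .
qed

lemma sum_Pow_not_small_differences_le:
  "(\<Sum>S\<in>Pow {0..<int n}. of_bool (\<not> small_differences n S)) \<le> real n * (3/4) ^ (n div 4) * 2 ^ n"
proof -
  let ?I = "{1..n - 1 - n div 2}"
  have "of_bool (\<not> small_differences n S) \<le> (\<Sum>d\<in>?I. of_bool (int d \<notin> diffset S) :: real)" for S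
  proof (cases "small_differences n S")
    case False
    then obtain d where d: "d \<in> ?I" "int d \<notin> diffset S" by (auto simp: small_differences_def)
    have "(1::real) = of_bool (int d \<notin> diffset S)" using d by simp
    also have "\<dots> \<le> (\<Sum>d\<in>?I. of_bool (int d \<notin> diffset S))"
      using d by (intro member_le_sum) auto
    finally show ?thesis using False by simp
  qed (simp del: sum_of_bool_eq add: sum_nonneg)
  then have "(\<Sum>S\<in>Pow {0..<int n}. of_bool (\<not> small_differences n S)) \<le>
      (\<Sum>S\<in>Pow {0..<int n}. \<Sum>d\<in>?I. of_bool (int d \<notin> diffset S) :: real)"
    by (intro sum_mono)
  also have "\<dots> = (\<Sum>d\<in>?I. \<Sum>S\<in>Pow {0..<int n}. of_bool (int d \<notin> diffset S))"
    by (rule sum.swap)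
  also have "\<dots> \<le> (\<Sum>d\<in>?I. (3/4) ^ (n div 4) * 2 ^ n)"
    by (intro sum_mono sum_Pow_missing_difference_le) auto
  also have "\<dots> \<le> real n * ((3/4) ^ (n div 4) * 2 ^ n)"
    unfolding sum_constant by (intro mult_right_mono) auto
  finally show ?thesis by (simp only: mult.assoc)
qed

text \<open>The two indicators agree whenever all small differences occur, so the error is at most
  the probability that one of them is missing.\<close>

lemma prob_missing_close:
  assumes "3 \<le> n"
  shows "\<bar>prob_missing k n - ext_mean 0 (n div 2) (\<lambda>j. of_bool (2 * j = k)) {} {}\<bar>
    \<le> real n * (3/4) ^ (n div 4)"
proof -
  let ?V = "Pow {0..<int n}"
  let ?a = "\<lambda>S. of_bool (2 * int n - 1 - int (card (diffset S)) = int k) :: real"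
  let ?b = "\<lambda>S. of_bool (2 * gaps (n div 2) (lower_half n S) (upper_half n S) = k) :: real"
  have a: "prob_missing k n = (\<Sum>S\<in>?V. ?a S) / 2 ^ n"
    unfolding prob_missing_def by (subst measure_pmf_of_set) (auto simp: card_Pow)
  have b: "ext_mean 0 (n div 2) (\<lambda>j. of_bool (2 * j = k)) {} {} = (\<Sum>S\<in>?V. ?b S) / 2 ^ n"
    using sum_Pow_halves[of "\<lambda>j. of_bool (2 * j = k)" n] by (simp del: sum_of_bool_eq)
  have "\<bar>(\<Sum>S\<in>?V. ?a S) - (\<Sum>S\<in>?V. ?b S)\<bar> \<le> (\<Sum>S\<in>?V. \<bar>?a S - ?b S\<bar>)"
    unfolding sum_subtractf[symmetric] by (rule sum_abs)
  also have "\<dots> \<le> (\<Sum>S\<in>?V. of_bool (\<not> small_differences n S))"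
  proof (rule sum_mono)
    fix S assume "S \<in> ?V"
    then show "\<bar>?a S - ?b S\<bar> \<le> of_bool (\<not> small_differences n S)"
      using missing_differences[of S n] assms by (cases "small_differences n S") auto
  qed
  also have "\<dots> \<le> real n * (3/4) ^ (n div 4) * 2 ^ n"
    by (rule sum_Pow_not_small_differences_le)
  finally show ?thesis
    unfolding a b diff_divide_distrib[symmetric] by (simp add: abs_divide pos_divide_le_eq del: sum_of_bool_eq)
qed

lemma error_tendsto_0: "(\<lambda>n. real n * (3/4) ^ (n div 4)) \<longlonglongrightarrow> 0"
proof (rule tendsto_sandwich[OF _ _ tendsto_const])
  have "(\<lambda>k. real k * (3/4) ^ k) \<longlonglongrightarrow> 0" "(\<lambda>k. (3/4) ^ k :: real) \<longlonglongrightarrow> 0"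
    by (intro powser_times_n_limit_0 LIMSEQ_realpow_zero; simp)+
  then have "(\<lambda>k. 4 * (real k * (3/4) ^ k) + 4 * (3/4) ^ k) \<longlonglongrightarrow> 4 * 0 + 4 * 0"
    by (intro tendsto_add tendsto_mult_left)
  then show "(\<lambda>n. 4 * (real (n div 4) * (3/4) ^ (n div 4)) + 4 * (3/4) ^ (n div 4)) \<longlonglongrightarrow> 0"
    by (intro filterlim_compose[OF _ filterlim_at_top_div_const_nat]) auto
  have "real n \<le> 4 * real (n div 4) + 4" for n
    by linarith
  then have "real n * (3/4) ^ (n div 4) \<le> (4 * real (n div 4) + 4) * (3/4) ^ (n div 4)" for n
    by (intro mult_right_mono) auto
  then show "eventually (\<lambda>n. real n * (3/4) ^ (n div 4) \<le>
      4 * (real (n div 4) * (3/4) ^ (n div 4)) + 4 * (3/4) ^ (n div 4)) sequentially"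
    by (simp add: algebra_simps)
qed simp

lemma prob_missing_tendsto: "prob_missing k \<longlonglongrightarrow> (if even k then gap_limit (k div 2) else 0)"
proof -
  let ?E = "\<lambda>n. ext_mean 0 n (\<lambda>j. of_bool (2 * j = k)) {} {}"
  have "?E = (\<lambda>n. if even k then gap_prob n (k div 2) else 0)"
  proof (cases "even k")
    case True
    then have "2 * j = k \<longleftrightarrow> j = k div 2" for j by auto
    with True show ?thesis by (simp add: gap_prob_def)
  next
    case False
    then have "2 * j \<noteq> k" for j by auto
    with False show ?thesis by simp
  qed
  then have "?E \<longlonglongrightarrow> (if even k then gap_limit (k div 2) else 0)"
    using gap_prob_tendsto by simp
  then have "(\<lambda>n. ?E (n div 2)) \<longlonglongrightarrow> (if even k then gap_limit (k div 2) else 0)"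
    by (rule filterlim_compose[OF _ filterlim_at_top_div_const_nat]) simp
  moreover have "(\<lambda>n. prob_missing k n - ?E (n div 2)) \<longlonglongrightarrow> 0"
    by (rule Lim_null_comparison[OF _ error_tendsto_0])
       (use prob_missing_close[of _ k] in \<open>auto intro!: eventually_sequentiallyI[of 3]\<close>)
  ultimately show ?thesis
    using tendsto_add by fastforce
qed

theorem theorem3p22:
  shows "(\<forall>k. convergent (prob_missing k)) \<and> (\<forall>k. k \<noteq> 4 \<longrightarrow> ell k < ell 4)"
proof -
  have ell: "ell k = (if even k then gap_limit (k div 2) else 0)" for k
    unfolding ell_def by (rule limI) (rule prob_missing_tendsto)
  have "ell k < ell 4" if "k \<noteq> 4" for k
  proof (cases "even k")
    case True
    with that have "k div 2 \<noteq> 2" by auto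
    then show ?thesis using True gap_limit_less by (simp add: ell)
  next
    case False
    then show ?thesis using gap_limit_less[of 0] gap_limit_nonneg[of 0] by (simp add: ell)
  qed
  moreover have "convergent (prob_missing k)" for k
    using prob_missing_tendsto convergentI by blast
  ultimately show ?thesis by blast
qed

end
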